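(* Let $p \in \mathbb{P}^*=(-\infty,0)\cup(1,\infty]$, $q \in (1,\infty)$ and $k \in (0,1)$. Then $$E_{p,q}(k)K_{p,q}(k')+K_{p,q}(k)E_{p,q}(k')-K_{p,q}(k)K_{p,q}(k')=\frac{\pi_{p,q}\,\pi_{s,q}}{4},$$ where $k':=(1-k^q)^{1/q}$ and $s$ is defined by $1/s=1/p-1/q$.
   Context: Conventions: $1/\infty=0$ and $1/0=\infty$. Let $\mathbb{P}^*:=(-\infty,0)\cup(1,\infty]$. For an index $s$, its conjugate $s^*$ is defined by $1/s+1/s^*=1$ (so $\infty^*=1$). For $p\in\mathbb{P}^*$, $q,r\in(1,\infty)$ and $k\in[0,1)$, the generalized complete elliptic integrals are $$K_{p,q,r}(k):=\int_0^1 \frac{dt}{(1-t^q)^{1/p}(1-k^qt^q)^{1/r}},\qquad E_{p,q,r}(k):=\int_0^1 \frac{(1-k^qt^q)^{1/r^*}}{(1-t^q)^{1/p}}\,dt,$$ where for $p=\infty$ the factor $(1-t^q)^{1/p}$ is read as $1$. Write $K_{p,q}:=K_{p,q,q^*}$ and $E_{p,q}:=E_{p,q,q^*}$, i.e. $K_{p,q}(k)=\int_0^1 (1-t^q)^{-1/p}(1-k^qt^q)^{-1/q^*}dt$ and $E_{p,q}(k)=\int_0^1 (1-t^q)^{-1/p}(1-k^qt^q)^{1/q}dt$. For $p\in\mathbb{P}^*$ and $q\in(1,\infty)$, $$\pi_{p,q}:=2\int_0^1\frac{dt}{(1-t^q)^{1/p}}=\frac{2}{q}B\left(\frac1q,\frac1{p^*}\right),$$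 where $B$ is the beta function; in particular $\pi_{\infty,q}=2$. *)

theory Defs
  imports "HOL-Analysis.Analysis"
begin

text \<open>
  The parameter \<open>p\<close> ranges over an extended-real set. In \<^typ>\<open>ereal\<close> one has \<open>1 / \<infinity> = 0\<close> and
  \<open>1 / 0 = \<infinity>\<close>, which are the conventions in force, so the exponent \<open>1/p\<close> is
  \<open>real_of_ereal (1 / p)\<close>, with value \<open>0\<close> for \<open>p = \<infinity>\<close>.
\<close>

definition Pstar :: "ereal set" where
  "Pstar = {-\<infinity><..<0} \<union> {1<..}"

definition conj_exponent :: "real \<Rightarrow> real" where
  "conj_exponent s = 1 / (1 - 1 / s)"

lemma conj_exponent_eq:
  assumes "1 < s"
  shows "1 / s + 1 / conj_exponent s = 1" and "1 < conj_exponent s"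
  using assms by (simp_all add: conj_exponent_def field_simps)

text \<open>
  Since \<open>0 powr a = 0\<close> for every \<open>a\<close>, also for \<open>a = 0\<close>, the integrands below may have a
  non-standard value at the endpoint \<open>t = 1\<close>; this does not affect the integrals.
\<close>

definition K3 :: "ereal \<Rightarrow> real \<Rightarrow> real \<Rightarrow> real \<Rightarrow> real" where
  "K3 p q r k = integral {0..1} (\<lambda>t. 1 /
     ((1 - t powr q) powr real_of_ereal (1 / p) * (1 - k powr q * t powr q) powr (1 / r)))"

definition E3 :: "ereal \<Rightarrow> real \<Rightarrow> real \<Rightarrow> real \<Rightarrow> real" where
  "E3 p q r k = integral {0..1} (\<lambda>t.
     (1 - k powr q * t powr q) powr (1 / conj_exponent r) /
     (1 - t powr q) powr real_of_ereal (1 / p))"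

definition K2 :: "ereal \<Rightarrow> real \<Rightarrow> real \<Rightarrow> real" where
  "K2 p q k = K3 p q (conj_exponent q) k"

definition E2 :: "ereal \<Rightarrow> real \<Rightarrow> real \<Rightarrow> real" where
  "E2 p q k = E3 p q (conj_exponent q) k"

definition gen_pi :: "ereal \<Rightarrow> real \<Rightarrow> real" where
  "gen_pi p q = 2 * integral {0..1} (\<lambda>t. 1 / (1 - t powr q) powr real_of_ereal (1 / p))"

text \<open>
  The equation \<open>1/s = 1/p - 1/q\<close> has exactly one solution \<open>s\<close> in \<^const>\<open>Pstar\<close>. For \<open>p = q\<close>
  this is \<open>s = \<infinity>\<close>; the only other solution in \<^typ>\<open>ereal\<close> is then \<open>- \<infinity>\<close>, which gives the
  same value of \<^const>\<open>gen_pi\<close>.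
\<close>

lemma gen_pi_MInfty: "gen_pi (- \<infinity>) q = gen_pi \<infinity> q"
  by (simp add: gen_pi_def)

lemma ex1_Pstar:
  assumes "p \<in> Pstar" "1 < q"
  shows "\<exists>!s. s \<in> Pstar \<and> 1 / s = 1 / p - 1 / ereal q"
proof -
  define a where "a = real_of_ereal (1 / p) - 1 / q"
  have a: "1 / p - 1 / ereal q = ereal a"
    using assms by (cases p) (auto simp: a_def Pstar_def one_ereal_def)
  have "real_of_ereal (1 / p) < 1"
    using assms(1) by (cases p) (auto simp: Pstar_def one_ereal_def divide_less_eq)
  moreover have "0 < 1 / q" using assms(2) by simp
  ultimately have "a < 1" unfolding a_def by linarith
  show ?thesis
  proof (cases "a = 0")
    case True
    show ?thesis unfolding a
    proof (rule ex1I[of _ \<infinity>])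
      fix s :: ereal assume "s \<in> Pstar \<and> 1 / s = ereal a"
      then show "s = \<infinity>" using True by (cases s) (auto simp: Pstar_def one_ereal_def split: if_splits)
    qed (simp add: True Pstar_def)
  next
    case False
    show ?thesis unfolding a
    proof (rule ex1I[of _ "ereal (1 / a)"])
      show "ereal (1 / a) \<in> Pstar \<and> 1 / ereal (1 / a) = ereal a"
        using False \<open>a < 1\<close> by (auto simp: Pstar_def one_ereal_def less_divide_eq divide_less_0_iff)
      fix s :: ereal assume "s \<in> Pstar \<and> 1 / s = ereal a"
      then show "s = ereal (1 / a)"
        using False by (cases s) (auto simp: Pstar_def one_ereal_def split: if_splits)
    qed
  qed
qed

end

theory Submission
  imports Defs
begin

text \<open>
  Put \<open>a = 1/p\<close>, \<open>b = 1/q\<close>, \<open>m = k\<^sup>q\<close> and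
  \<open>M\<^sub>c(m) = \<integral>\<^sub>0\<^sup>1 (1 - t\<^sup>q)\<^sup>-\<^sup>a (1 - m t\<^sup>q)\<^sup>c dt\<close>. Then \<open>K = M\<^sub>b\<^sub>-\<^sub>1(m)\<close> and
  \<open>E = M\<^sub>b(m)\<close>, and passing from \<open>k\<close> to \<open>k'\<close> replaces \<open>m\<close> by \<open>1 - m\<close>. The argument is the one
  by which Legendre's relation is usually proved: the left-hand side, as a function \<open>L(m)\<close>, has
  derivative zero, and its constant value is read off at the degenerate modulus \<open>m \<rightarrow> 0\<close>.

  For the derivative, differentiating under the integral sign gives
  \<open>M\<^sub>c' = (c/m) (M\<^sub>c - M\<^sub>c\<^sub>-\<^sub>1)\<close> (\<open>euler_integral_has_derivative\<close>). With \<open>c = b\<close> this is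
  \<open>E' = (b/m) (E - K)\<close>. With \<open>c = b - 1\<close> it produces the third integral \<open>M\<^sub>b\<^sub>-\<^sub>2\<close>, which
  the contiguity relation between \<open>M\<^sub>c\<^sub>+\<^sub>1, M\<^sub>c, M\<^sub>c\<^sub>-\<^sub>1\<close> (\<open>euler_integral_contiguous\<close>, an
  integration by parts) expresses by \<open>E\<close> and \<open>K\<close>. So \<open>(E, K)\<close> solves a linear system of first
  order; it is the relation \<open>q b = 1\<close> that makes all terms of \<open>L'\<close> cancel
  (\<open>legendre_relation_constant\<close>).

  For the value, write \<open>L(m) = (E - K)(m) K(1 - m) + K(m) E(1 - m)\<close>. Although \<open>K(1 - m)\<close> may
  blow up, it is \<open>O(m\<^sup>b\<^sup>-\<^sup>1)\<close>, whereas \<open>E - K = O(m)\<close>; hence the first summand tends to \<open>0\<close>.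
  The second tends to \<open>K(0) E(1)\<close>, where \<open>K(0) = \<pi>\<^sub>p\<^sub>,\<^sub>q / 2\<close>, and
  \<open>E(1) = \<integral>\<^sub>0\<^sup>1 (1 - t\<^sup>q)\<^sup>b\<^sup>-\<^sup>a dt = \<pi>\<^sub>s\<^sub>,\<^sub>q / 2\<close> because \<open>1/s = a - b\<close>
  (\<open>legendre_relation\<close>).
\<close>

section \<open>Integrals depending on a parameter, against an integrable weight\<close>

lemma absolutely_integrable_mult_continuous:
  fixes w g :: "real \<Rightarrow> real"
  assumes "compact T" "w absolutely_integrable_on T" "continuous_on T g"
  shows "(\<lambda>t. w t * g t) absolutely_integrable_on T"
proof -
  have T: "T \<in> sets lebesgue"
    using assms(1) by (simp add: borel_compact sets_completionI_sets)
  have "(\<lambda>t. g t * w t) absolutely_integrable_on T"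
  proof (rule absolutely_integrable_bounded_measurable_product_real)
    show "g \<in> borel_measurable (lebesgue_on T)"
      using assms T by (intro continuous_imp_measurable_on_sets_lebesgue)
    show "bounded (g ` T)"
      using assms compact_continuous_image compact_imp_bounded by blast
  qed (use assms T in auto)
  then show ?thesis by (simp add: mult.commute)
qed

lemma integrable_mult_continuous:
  fixes w g :: "real \<Rightarrow> real"
  assumes "compact T" "w absolutely_integrable_on T" "continuous_on T g"
  shows "(\<lambda>t. w t * g t) integrable_on T"
  using absolutely_integrable_mult_continuous[OF assms]
  by (simp add: absolutely_integrable_on_def)

lemma weighted_integral_abs_le:
  fixes w g :: "real \<Rightarrow> real"
  assumes "compact T" "w absolutely_integrable_on T" "continuous_on T g"
    and "\<And>t. t \<in> T \<Longrightarrow> \<bar>g t\<bar> \<le> B"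
  shows "\<bar>integral T (\<lambda>t. w t * g t)\<bar> \<le> B * integral T (\<lambda>t. \<bar>w t\<bar>)"
proof -
  have "(\<lambda>t. \<bar>w t\<bar>) integrable_on T"
    using assms(2) by (simp add: absolutely_integrable_on_def)
  moreover have "norm (w t * g t) \<le> B * \<bar>w t\<bar>" if "t \<in> T" for t
    using mult_right_mono[OF assms(4)[OF that], of "\<bar>w t\<bar>"] by (simp add: abs_mult mult.commute)
  ultimately have "norm (integral T (\<lambda>t. w t * g t)) \<le> integral T (\<lambda>t. B * \<bar>w t\<bar>)"
    using integrable_mult_continuous[OF assms(1-3)]
    by (intro integral_norm_bound_integral integrable_on_mult_right) auto
  then show ?thesis by simp
qed

lemma continuous_on_section:
  assumes "continuous_on (S \<times> T) (\<lambda>(x, t). \<phi> x t)" "x \<in> S"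
  shows "continuous_on T (\<phi> x)"
proof -
  have "continuous_on T (\<lambda>t. (x, t))"
    by (intro continuous_on_Pair continuous_on_const continuous_on_id)
  then have "continuous_on T (\<lambda>t. (\<lambda>(x, t). \<phi> x t) (x, t))"
    by (rule continuous_on_compose2[OF assms(1)]) (use assms(2) in auto)
  then show ?thesis by simp
qed

text \<open>
  The weight may be unbounded, so the integrand itself need not be continuous in both variables.
  It suffices that the other factor is: on a compact set its oscillation is uniformly small, and the
  integral changes by at most that oscillation times the mass of the weight.
\<close>

lemma weighted_integral_continuous_on:
  fixes w :: "real \<Rightarrow> real" and \<phi> :: "'a::metric_space \<Rightarrow> real \<Rightarrow> real"
  assumes "compact S" "compact T" and w: "w absolutely_integrable_on T"
    and cont: "continuous_on (S \<times> T) (\<lambda>(x, t). \<phi> x t)"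
  shows "continuous_on S (\<lambda>x. integral T (\<lambda>t. w t * \<phi> x t))"
  unfolding continuous_on_iff
proof (intro ballI allI impI)
  fix x and e :: real assume x: "x \<in> S" and e: "e > 0"
  define W where "W = integral T (\<lambda>t. \<bar>w t\<bar>)"
  have W: "W \<ge> 0" unfolding W_def by (rule integral_nonneg)
      (use w in \<open>auto simp: absolutely_integrable_on_def\<close>)
  \<comment> \<open>Adding \<open>1\<close> covers a weight of mass zero.\<close>
  define e' where "e' = e / (1 + W)"
  have e': "e' > 0" "e' * W < e" using e W by (auto simp: e'_def field_simps)
  have cx: "continuous_on T (\<phi> y)" if "y \<in> S" for y
    using continuous_on_section[OF cont that] .
  have "uniformly_continuous_on (S \<times> T) (\<lambda>(x, t). \<phi> x t)"
    using assms by (intro compact_uniformly_continuous compact_Times)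
  then obtain d where d: "d > 0"
    and close: "\<And>y t. \<lbrakk>y \<in> S; t \<in> T; dist y x < d\<rbrakk> \<Longrightarrow> \<bar>\<phi> y t - \<phi> x t\<bar> < e'"
    using e'(1) x unfolding uniformly_continuous_on_def
    by (fastforce simp: dist_Pair_Pair dist_real_def)
  show "\<exists>d>0. \<forall>y\<in>S. dist y x < d \<longrightarrow>
      dist (integral T (\<lambda>t. w t * \<phi> y t)) (integral T (\<lambda>t. w t * \<phi> x t)) < e"
  proof (intro exI[of _ d] conjI ballI impI d)
    fix y assume y: "y \<in> S" "dist y x < d"
    have "integral T (\<lambda>t. w t * \<phi> y t) - integral T (\<lambda>t. w t * \<phi> x t)
        = integral T (\<lambda>t. w t * (\<phi> y t - \<phi> x t))"
      using integrable_mult_continuous[OF assms(2) w cx] x y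
      by (simp add: Henstock_Kurzweil_Integration.integral_diff right_diff_distrib)
    also have "\<bar>\<dots>\<bar> \<le> e' * W"
      unfolding W_def using close y x less_imp_le
      by (intro weighted_integral_abs_le assms continuous_on_diff cx) blast+
    finally show "dist (integral T (\<lambda>t. w t * \<phi> y t)) (integral T (\<lambda>t. w t * \<phi> x t)) < e"
      using e' by (simp add: dist_real_def)
  qed
qed

text \<open>
  The same principle for derivatives: by the mean value theorem, uniform continuity of \<open>\<phi>'\<close> makes
  the linearization error of \<open>\<phi>\<close> at most \<open>e' \<bar>y - x\<bar>\<close> with \<open>e'\<close> independent of \<open>t\<close>.
\<close>

lemma weighted_integral_has_derivative:
  fixes w :: "real \<Rightarrow> real" and \<phi> \<phi>' :: "real \<Rightarrow> real \<Rightarrow> real"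
  assumes "convex S" "compact S" "compact T" and w: "w absolutely_integrable_on T"
    and der: "\<And>x t. \<lbrakk>x \<in> S; t \<in> T\<rbrakk> \<Longrightarrow>
           ((\<lambda>x. \<phi> x t) has_real_derivative \<phi>' x t) (at x within S)"
    and cont: "\<And>x. x \<in> S \<Longrightarrow> continuous_on T (\<phi> x)"
    and cont': "continuous_on (S \<times> T) (\<lambda>(x, t). \<phi>' x t)"
    and x: "x \<in> S"
  shows "((\<lambda>x. integral T (\<lambda>t. w t * \<phi> x t)) has_real_derivative
           integral T (\<lambda>t. w t * \<phi>' x t)) (at x within S)"
  unfolding has_field_derivative_def has_derivative_within_alt
proof (intro conjI allI impI bounded_linear_mult_right)
  fix e :: real assume e: "e > 0"
  define W where "W = integral T (\<lambda>t. \<bar>w t\<bar>)"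
  have W: "W \<ge> 0" unfolding W_def by (rule integral_nonneg)
      (use w in \<open>auto simp: absolutely_integrable_on_def\<close>)
  \<comment> \<open>Adding \<open>1\<close> covers a weight of mass zero.\<close>
  define e' where "e' = e / (1 + W)"
  have e': "e' > 0" "e' * W \<le> e" using e W by (auto simp: e'_def field_simps)
  have cx': "continuous_on T (\<phi>' x)"
    using continuous_on_section[OF cont' x] .
  have "uniformly_continuous_on (S \<times> T) (\<lambda>(x, t). \<phi>' x t)"
    using assms by (intro compact_uniformly_continuous compact_Times)
  then obtain d where d: "d > 0"
    and close: "\<And>y t. \<lbrakk>y \<in> S; t \<in> T; dist y x < d\<rbrakk> \<Longrightarrow> \<bar>\<phi>' y t - \<phi>' x t\<bar> < e'"
    using e'(1) x unfolding uniformly_continuous_on_def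
    by (fastforce simp: dist_Pair_Pair dist_real_def)
  show "\<exists>d>0. \<forall>y\<in>S. norm (y - x) < d \<longrightarrow>
      norm (integral T (\<lambda>t. w t * \<phi> y t) - integral T (\<lambda>t. w t * \<phi> x t)
        - integral T (\<lambda>t. w t * \<phi>' x t) * (y - x)) \<le> e * norm (y - x)"
  proof (intro exI[of _ d] conjI ballI impI d)
    fix y assume y: "y \<in> S" "norm (y - x) < d"
    have lin: "\<bar>\<phi> y t - \<phi> x t - \<phi>' x t * (y - x)\<bar> \<le> e' * \<bar>y - x\<bar>" if t: "t \<in> T" for t
    proof -
      let ?C = "S \<inter> ball x d"
      have "norm ((\<phi> y t - \<phi>' x t * y) - (\<phi> x t - \<phi>' x t * x)) \<le> e' * norm (y - x)"
      proof (rule field_differentiable_bound[of ?C _ "\<lambda>z. \<phi>' z t - \<phi>' x t"])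
        show "convex ?C" using assms by (simp add: convex_Int)
        show "((\<lambda>z. \<phi> z t - \<phi>' x t * z) has_field_derivative \<phi>' z t - \<phi>' x t) (at z within ?C)"
          if "z \<in> ?C" for z
          using that t by (auto intro!: derivative_eq_intros DERIV_subset[OF der])
        show "norm (\<phi>' z t - \<phi>' x t) \<le> e'" if "z \<in> ?C" for z
          using close[of z t] that t by (simp add: dist_commute less_imp_le)
      qed (use x y d in \<open>auto simp: dist_real_def\<close>)
      then show ?thesis by (simp add: algebra_simps)
    qed
    have "integral T (\<lambda>t. w t * \<phi> y t) - integral T (\<lambda>t. w t * \<phi> x t)
            - integral T (\<lambda>t. w t * \<phi>' x t) * (y - x)
        = integral T (\<lambda>t. w t * \<phi> y t - w t * \<phi> x t - w t * \<phi>' x t * (y - x))"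
      using integrable_mult_continuous[OF assms(3) w cont[OF x]]
        integrable_mult_continuous[OF assms(3) w cont[OF y(1)]]
        integrable_mult_continuous[OF assms(3) w cx']
      by (simp add: Henstock_Kurzweil_Integration.integral_diff integrable_diff
          integrable_on_mult_left)
    also have "\<dots> = integral T (\<lambda>t. w t * (\<phi> y t - \<phi> x t - \<phi>' x t * (y - x)))"
      by (simp add: algebra_simps)
    also have "\<bar>\<dots>\<bar> \<le> (e' * \<bar>y - x\<bar>) * W"
      unfolding W_def using lin x y
      by (intro weighted_integral_abs_le assms continuous_intros cont cx') auto
    also have "\<dots> \<le> e * \<bar>y - x\<bar>"
      using mult_right_mono[OF e'(2), of "\<bar>y - x\<bar>"] by (simp add: mult_ac)
    finally show "norm (integral T (\<lambda>t. w t * \<phi> y t) - integral T (\<lambda>t. w t * \<phi> x t)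
        - integral T (\<lambda>t. w t * \<phi>' x t) * (y - x)) \<le> e * norm (y - x)" by simp
  qed
qed

section \<open>Euler integrals\<close>

definition euler_weight :: "real \<Rightarrow> real \<Rightarrow> real \<Rightarrow> real" where
  "euler_weight a q t = 1 / (1 - t powr q) powr a"

text \<open>
  After the substitution \<open>u = t\<^sup>q\<close> this is Euler's integral for a multiple of the hypergeometric
  function \<open>F(-c, 1/q; 1/q + 1 - a; m)\<close>.
\<close>

definition euler_integral :: "real \<Rightarrow> real \<Rightarrow> real \<Rightarrow> real \<Rightarrow> real" where
  "euler_integral a q c m =
     integral {0..1} (\<lambda>t. euler_weight a q t * (1 - m * t powr q) powr c)"

lemma powr_le_self:
  fixes t q :: real
  assumes "0 \<le> t" "t \<le> 1" "1 \<le> q"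
  shows "t powr q \<le> t"
  using powr_mono'[of 1 q t] assms by simp

lemma one_minus_mult_powr_pos:
  fixes t q x :: real
  assumes "t \<in> {0..1}" "1 \<le> q" "0 \<le> x" "x < 1"
  shows "0 < 1 - x * t powr q"
proof -
  have "x * t powr q \<le> x * 1"
    using assms by (intro mult_left_mono order_trans[OF powr_le_self]) auto
  then show ?thesis using assms by linarith
qed

text \<open>
  Since \<open>1 - t \<le> 1 - t\<^sup>q \<le> 1\<close>, the weight is dominated by the integrable function
  \<open>(1 - t)\<^sup>-\<^sup>b\<close>, where \<open>b\<close> is the positive part of \<open>a\<close>.
\<close>

lemma euler_weight_absolutely_integrable:
  assumes "a < 1" "1 \<le> q"
  shows "euler_weight a q absolutely_integrable_on {0..1}"
proof -
  define b where "b = max a 0"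
  have b: "0 \<le> b" "b < 1" "a \<le> b" using assms by (auto simp: b_def)
  have "((\<lambda>t. (1 - t) powr (- b)) has_integral
      (- ((1 - 1) powr (1 - b) / (1 - b)) - - ((1 - 0) powr (1 - b) / (1 - b)))) {0..1::real}"
  proof (rule fundamental_theorem_of_calculus_interior)
    show "continuous_on {0..1} (\<lambda>t. - ((1 - t) powr (1 - b) / (1 - b)))"
      using b by (auto intro!: continuous_intros continuous_on_powr')
    show "((\<lambda>t. - ((1 - t) powr (1 - b) / (1 - b))) has_vector_derivative (1 - t) powr (- b)) (at t)"
      if "t \<in> {0<..<1}" for t
    proof -
      have "((\<lambda>t. 1 - t) has_real_derivative - 1) (at t)" by (auto intro!: derivative_eq_intros)
      then have "((\<lambda>t. (1 - t) powr (1 - b)) has_real_derivative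
          (1 - b) * (1 - t) powr (1 - b - of_nat 1) * - 1) (at t)"
        using that by (intro DERIV_fun_powr) auto
      then have "((\<lambda>t. - ((1 - t) powr (1 - b) / (1 - b))) has_real_derivative
          - ((1 - b) * (1 - t) powr (1 - b - of_nat 1) * - 1 / (1 - b))) (at t)"
        by (intro DERIV_minus DERIV_cdivide)
      then show ?thesis
        using b by (simp add: has_real_derivative_iff_has_vector_derivative)
    qed
  qed auto
  then have int: "(\<lambda>t. (1 - t) powr (- b)) integrable_on {0..1::real}" by blast
  show ?thesis
  proof (rule measurable_bounded_by_integrable_imp_absolutely_integrable[OF _ _ int])
    have "euler_weight a q \<in> borel_measurable lborel"
      unfolding euler_weight_def by measurable
    then show "euler_weight a q \<in> borel_measurable (lebesgue_on {0..1})"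
      by (intro measurable_restrict_space1 measurable_completion)
    fix t :: real assume t: "t \<in> {0..1}"
    show "norm (euler_weight a q t) \<le> (1 - t) powr (- b)"
    proof (cases "t = 1")
      case False
      then have pos: "0 < 1 - t" "1 - t \<le> 1 - t powr q" "1 - t powr q \<le> 1"
        using t powr_le_self[of t q] assms by auto
      have "norm (euler_weight a q t) = (1 - t powr q) powr (- a)"
        by (simp add: euler_weight_def powr_minus divide_inverse)
      also have "\<dots> \<le> (1 - t powr q) powr (- b)"
        using pos b by (intro powr_mono') auto
      also have "\<dots> \<le> (1 - t) powr (- b)"
        using pos b by (intro powr_mono2') auto
      finally show ?thesis .
    qed (simp add: euler_weight_def)
  qed auto
qed

text \<open>
  The base vanishes only at \<open>x = t = 1\<close>, where a positive exponent keeps the power continuous. This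
  second alternative is what allows \<open>E\<close> to be evaluated at modulus one.
\<close>

lemma euler_kernel_continuous_on:
  fixes q c :: real
  assumes "1 \<le> q" "X \<subseteq> {0..<1} \<or> X \<subseteq> {0..1} \<and> 0 < c"
  shows "continuous_on (X \<times> {0..1}) (\<lambda>(x, t). (1 - x * t powr q) powr c)"
proof -
  have "0 \<le> 1 - x * t powr q \<and> (1 - x * t powr q = 0 \<longrightarrow> 0 < c)"
    if "x \<in> X" "t \<in> {0..1}" for x t
  proof (cases "x < 1")
    case True
    then show ?thesis using one_minus_mult_powr_pos[of t q x] that assms by fastforce
  next
    case False
    then have "x = 1" "0 < c" using that assms by force+
    then show ?thesis using powr_le_self[of t q] that assms by auto
  qed
  then show ?thesis
    unfolding case_prod_unfold using assms
    by (intro continuous_on_powr' continuous_intros) auto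
qed

lemma euler_kernel_continuous_on_section:
  fixes q c :: real
  assumes "1 \<le> q" "0 \<le> x" "x < 1 \<or> x = 1 \<and> 0 < c"
  shows "continuous_on {0..1} (\<lambda>t. (1 - x * t powr q) powr c)"
  using assms
  by (intro continuous_on_section[OF euler_kernel_continuous_on[of q "{x}" c]]) auto

lemma euler_integrand_integrable:
  assumes "a < 1" "1 \<le> q" "0 \<le> x" "x < 1"
  shows "(\<lambda>t. euler_weight a q t * (1 - x * t powr q) powr c) integrable_on {0..1}"
  using assms
  by (intro integrable_mult_continuous euler_weight_absolutely_integrable
      euler_kernel_continuous_on_section) auto

lemma euler_integral_continuous_on:
  assumes "a < 1" "1 \<le> q" "compact X" "X \<subseteq> {0..<1} \<or> X \<subseteq> {0..1} \<and> 0 < c"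
  shows "continuous_on X (euler_integral a q c)"
  unfolding euler_integral_def using assms
  by (intro weighted_integral_continuous_on euler_weight_absolutely_integrable
      euler_kernel_continuous_on) auto

text \<open>
  Differentiation of the kernel produces the factor \<open>- t\<^sup>q\<close>, which is
  \<open>((1 - m t\<^sup>q) - 1) / m\<close>; so the derivative is again a combination of Euler integrals.
\<close>

lemma euler_integral_has_derivative:
  assumes "a < 1" "1 \<le> q" "0 < m" "m < 1"
  shows "(euler_integral a q c has_real_derivative
           c / m * (euler_integral a q c m - euler_integral a q (c - 1) m)) (at m)"
proof -
  \<comment> \<open>A compact neighbourhood of \<open>m\<close> on which the base of the kernel stays positive.\<close>
  define S where "S = {0..(1 + m) / 2}"
  have S: "S \<subseteq> {0..<1}" "m \<in> S" "m \<in> interior S" using assms by (auto simp: S_def)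
  define \<phi>' where "\<phi>' = (\<lambda>x t. - c * t powr q * (1 - x * t powr q) powr (c - 1))"
  have "(euler_integral a q c has_real_derivative
      integral {0..1} (\<lambda>t. euler_weight a q t * \<phi>' m t)) (at m within S)"
    unfolding euler_integral_def
  proof (rule weighted_integral_has_derivative)
    show "((\<lambda>x. (1 - x * t powr q) powr c) has_real_derivative \<phi>' x t) (at x within S)"
      if "x \<in> S" "t \<in> {0..1}" for x t
    proof -
      have "0 < 1 - x * t powr q"
        using one_minus_mult_powr_pos[of t q x] that S assms by auto
      then show ?thesis
        by (auto intro!: derivative_eq_intros simp: \<phi>'_def powr_diff)
    qed
    have "continuous_on (S \<times> {0..1}) (\<lambda>z. - c * snd z powr q)"
      using assms by (intro continuous_intros continuous_on_powr') auto
    then show "continuous_on (S \<times> {0..1}) (\<lambda>(x, t). \<phi>' x t)"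
      using continuous_on_mult[OF _ euler_kernel_continuous_on[of q S "c - 1"]] S assms
      unfolding \<phi>'_def case_prod_unfold by blast
    show "continuous_on {0..1} (\<lambda>t. (1 - x * t powr q) powr c)" if "x \<in> S" for x
      using that S assms by (intro euler_kernel_continuous_on_section) auto
  qed (use assms S in \<open>auto simp: S_def intro!: euler_weight_absolutely_integrable\<close>)
  moreover have "integral {0..1} (\<lambda>t. euler_weight a q t * \<phi>' m t)
      = c / m * (euler_integral a q c m - euler_integral a q (c - 1) m)"
  proof -
    have "euler_weight a q t * \<phi>' m t = c / m * (euler_weight a q t * (1 - m * t powr q) powr c
        - euler_weight a q t * (1 - m * t powr q) powr (c - 1))" if "t \<in> {0..1}" for t
    proof -
      have "0 < 1 - m * t powr q"
        using one_minus_mult_powr_pos[of t q m] that assms by auto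
      then have "(1 - m * t powr q) powr c = (1 - m * t powr q) * (1 - m * t powr q) powr (c - 1)"
        by (simp add: powr_diff)
      then show ?thesis unfolding \<phi>'_def using assms(3) by (simp only:) (simp add: field_simps)
    qed
    then have "integral {0..1} (\<lambda>t. euler_weight a q t * \<phi>' m t) = integral {0..1} (\<lambda>t. c / m *
        (euler_weight a q t * (1 - m * t powr q) powr c
          - euler_weight a q t * (1 - m * t powr q) powr (c - 1)))"
      by (intro Henstock_Kurzweil_Integration.integral_cong) auto
    then show ?thesis
      unfolding euler_integral_def using euler_integrand_integrable[of a q m] assms
      by (simp add: Henstock_Kurzweil_Integration.integral_diff)
  qed
  ultimately show ?thesis
    using at_within_interior[OF S(3)] by simp
qed

text \<open>
  The function \<open>m t (1 - t\<^sup>q)\<^sup>1\<^sup>-\<^sup>a (1 - m t\<^sup>q)\<^sup>c\<close> vanishes at both ends of \<open>{0..1}\<close>, so its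
  derivative has integral zero. That derivative is \<open>(1 - t\<^sup>q)\<^sup>-\<^sup>a y\<^sup>c\<^sup>-\<^sup>1\<close> times a
  quadratic polynomial in \<open>y = 1 - m t\<^sup>q\<close>, whose three coefficients are those of the relation.
\<close>

lemma euler_integral_contiguous:
  assumes "a < 1" "1 \<le> q" "0 < m" "m < 1"
  shows "(1 + q * (1 - a) + q * c) * euler_integral a q (c + 1) m
       + q * c * (1 - m) * euler_integral a q (c - 1) m
       = ((1 - m) + q * (1 - a) + q * c * (2 - m)) * euler_integral a q c m"
proof -
  define F where "F = (\<lambda>t. m * t * (1 - t powr q) powr (1 - a) * (1 - m * t powr q) powr c)"
  define g where "g = (\<lambda>t.
      (1 + q * (1 - a) + q * c) * (euler_weight a q t * (1 - m * t powr q) powr (c + 1))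
      + q * c * (1 - m) * (euler_weight a q t * (1 - m * t powr q) powr (c - 1))
      - ((1 - m) + q * (1 - a) + q * c * (2 - m)) *
          (euler_weight a q t * (1 - m * t powr q) powr c))"
  have "(g has_integral F 1 - F 0) {0..1}"
  proof (rule fundamental_theorem_of_calculus_interior)
    show "continuous_on {0..1} F"
      using euler_kernel_continuous_on_section[of q 1 "1 - a"] assms unfolding F_def
      by (intro continuous_on_mult euler_kernel_continuous_on_section continuous_on_const
          continuous_on_id) auto
    fix t :: real assume t: "t \<in> {0<..<1}"
    define u where "u = t powr q"
    define y where "y = 1 - m * u"
    have u: "0 < u" "u < 1" using t assms powr_le_self[of t q] by (auto simp: u_def)
    have y: "0 < y" using one_minus_mult_powr_pos[of t q m] t assms by (simp add: u_def y_def)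
    have pow: "t powr (q - 1) * t = u" "(1 - u) powr (1 - a) = (1 - u) * (1 - u) powr (- a)"
      "y powr (c + 1) = y\<^sup>2 * y powr (c - 1)" "y powr c = y * y powr (c - 1)"
      using t u y by (auto simp: u_def powr_diff powr_add powr_minus field_simps power2_eq_square)
    have weight: "euler_weight a q t = (1 - u) powr (- a)"
      by (simp add: euler_weight_def u_def powr_minus divide_inverse)
    have gt: "g t = (1 - u) powr (- a) * y powr (c - 1) *
        ((1 + q * (1 - a) + q * c) * y\<^sup>2 + q * c * (1 - m)
          - ((1 - m) + q * (1 - a) + q * c * (2 - m)) * y)"
      unfolding g_def u_def[symmetric] y_def[symmetric] weight pow(3,4) by (simp add: algebra_simps)
    have d1: "((\<lambda>t. t powr q) has_real_derivative q * t powr (q - 1)) (at t)"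
      using t by (auto intro!: derivative_eq_intros)
    have d2: "((\<lambda>t. (1 - t powr q) powr (1 - a)) has_real_derivative
        (1 - a) * (1 - u) powr (- a) * (- (q * t powr (q - 1)))) (at t)"
      using DERIV_fun_powr[OF DERIV_diff[OF DERIV_const d1], of 1 "1 - a"] u
      by (simp add: u_def)
    have d3: "((\<lambda>t. (1 - m * t powr q) powr c) has_real_derivative
        c * y powr (c - 1) * (- (m * (q * t powr (q - 1))))) (at t)"
      using DERIV_fun_powr[OF DERIV_diff[OF DERIV_const DERIV_cmult[OF d1, of m]], of 1 c] y
      by (simp add: u_def y_def)
    have "(F has_real_derivative
        m * (1 - u) powr (1 - a) * y powr c
        + m * t * ((1 - a) * (1 - u) powr (- a) * (- (q * t powr (q - 1)))) * y powr c
        + m * t * (1 - u) powr (1 - a) * (c * y powr (c - 1) * (- (m * (q * t powr (q - 1)))))) (at t)"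
      unfolding F_def
      by (rule derivative_eq_intros d2 d3 refl)+ (simp add: u_def y_def algebra_simps)
    moreover have "m * (1 - u) powr (1 - a) * y powr c
        + m * t * ((1 - a) * (1 - u) powr (- a) * (- (q * t powr (q - 1)))) * y powr c
        + m * t * (1 - u) powr (1 - a) * (c * y powr (c - 1) * (- (m * (q * t powr (q - 1)))))
        = (1 - u) powr (- a) * y powr (c - 1) *
          (m * (1 - u) * y - q * (1 - a) * m * (t powr (q - 1) * t) * y
            - q * c * (m * (1 - u)) * (m * (t powr (q - 1) * t)))"
      unfolding pow(2,4) by (simp add: algebra_simps)
    moreover have "m * (1 - u) * y - q * (1 - a) * m * u * y - q * c * (m * (1 - u)) * (m * u)
        = (1 + q * (1 - a) + q * c) * y\<^sup>2 + q * c * (1 - m)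
          - ((1 - m) + q * (1 - a) + q * c * (2 - m)) * y"
      unfolding y_def by (simp add: algebra_simps power2_eq_square)
    ultimately show "(F has_vector_derivative g t) (at t)"
      unfolding has_real_derivative_iff_has_vector_derivative[symmetric] gt pow(1)
      by simp
  qed simp
  moreover have "F 1 - F 0 = 0" using assms by (simp add: F_def)
  moreover have "((\<lambda>t. euler_weight a q t * (1 - m * t powr q) powr e) has_integral
      euler_integral a q e m) {0..1}" for e
    using euler_integrand_integrable[of a q m e] assms
    by (simp add: euler_integral_def integrable_integral)
  then have "(g has_integral
      (1 + q * (1 - a) + q * c) * euler_integral a q (c + 1) m
      + q * c * (1 - m) * euler_integral a q (c - 1) m
      - ((1 - m) + q * (1 - a) + q * c * (2 - m)) * euler_integral a q c m) {0..1}"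
    unfolding g_def by (intro has_integral_diff has_integral_add has_integral_mult_right)
  ultimately have "F 1 - F 0 = (1 + q * (1 - a) + q * c) * euler_integral a q (c + 1) m
      + q * c * (1 - m) * euler_integral a q (c - 1) m
      - ((1 - m) + q * (1 - a) + q * c * (2 - m)) * euler_integral a q c m"
    by (intro has_integral_unique)
  then show ?thesis using \<open>F 1 - F 0 = 0\<close> by linarith
qed

section \<open>The Legendre relation\<close>

text \<open>
  This is the derivative of \<open>K\<close> in terms of \<open>E\<close> and \<open>K\<close>: the contiguity relation at
  \<open>c = 1/q - 1\<close> eliminates the integral with exponent \<open>1/q - 2\<close>.
\<close>

lemma euler_integral_inverse_minus_1_has_derivative:
  assumes "a < 1" "1 < q" "0 < m" "m < 1"
  defines "b \<equiv> 1 / q"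
  shows "(euler_integral a q (b - 1) has_real_derivative
           ((2 * b - a) * euler_integral a q b m
             + (a - b - b * (1 - m)) * euler_integral a q (b - 1) m) / (m * (1 - m))) (at m)"
proof -
  have "q * b = 1" using assms by (simp add: b_def)
  define E K J where "E = euler_integral a q b m" and "K = euler_integral a q (b - 1) m"
    and "J = euler_integral a q (b - 1 - 1) m"
  have "(1 + q * (1 - a) + q * (b - 1)) * E + q * (b - 1) * (1 - m) * J
      = ((1 - m) + q * (1 - a) + q * (b - 1) * (2 - m)) * K"
    using euler_integral_contiguous[of a q m "b - 1"] assms by (simp add: E_def K_def J_def)
  then have "b * ((1 + q * (1 - a) + q * (b - 1)) * E + q * (b - 1) * (1 - m) * J)
      = b * (((1 - m) + q * (1 - a) + q * (b - 1) * (2 - m)) * K)" by simp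
  then have "(b - 1) * (1 - m) * J = ((1 - m) * b + (1 - a) + (b - 1) * (2 - m)) * K - (2 * b - a) * E"
    using \<open>q * b = 1\<close> by algebra
  then have "(b - 1) * (K - J) * (1 - m) = (2 * b - a) * E + (a - b - b * (1 - m)) * K"
    by (simp add: algebra_simps)
  moreover have "(b - 1) / m * (K - J) = (b - 1) * (K - J) * (1 - m) / (m * (1 - m))"
    using assms(3,4) by simp
  ultimately have "(b - 1) / m * (K - J)
      = ((2 * b - a) * E + (a - b - b * (1 - m)) * K) / (m * (1 - m))"
    by simp
  then show ?thesis
    using euler_integral_has_derivative[of a q m "b - 1"] assms by (simp add: E_def K_def J_def)
qed

text \<open>
  Inserting the derivatives of \<open>E\<close> and \<open>K\<close> at \<open>m\<close> and, with reversed sign, at \<open>1 - m\<close>, the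
  coefficient of each of the four products \<open>E(m) E(1 - m)\<close>, \<open>E(m) K(1 - m)\<close>, \<open>K(m) E(1 - m)\<close>,
  \<open>K(m) K(1 - m)\<close> vanishes.
\<close>

lemma legendre_relation_constant:
  assumes "a < 1" "1 < q"
  defines "E \<equiv> euler_integral a q (1 / q)" and "K \<equiv> euler_integral a q (1 / q - 1)"
  obtains C where "\<And>m. \<lbrakk>0 < m; m < 1\<rbrakk> \<Longrightarrow>
    E m * K (1 - m) + K m * E (1 - m) - K m * K (1 - m) = C"
proof -
  define b where "b = 1 / q"
  have "((\<lambda>m. E m * K (1 - m) + K m * E (1 - m) - K m * K (1 - m)) has_real_derivative 0) (at m)"
    if m: "0 < m" "m < 1" for m
  proof -
    let ?E' = "\<lambda>m. b / m * (E m - K m)"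
    let ?K' = "\<lambda>m. ((2 * b - a) * E m + (a - b - b * (1 - m)) * K m) / (m * (1 - m))"
    have dE: "(E has_real_derivative ?E' x) (at x)" if "0 < x" "x < 1" for x
      using euler_integral_has_derivative[of a q x b] assms(1,2) that
      by (simp add: E_def K_def b_def)
    have dK: "(K has_real_derivative ?K' x) (at x)" if "0 < x" "x < 1" for x
      using euler_integral_inverse_minus_1_has_derivative[of a q x] assms(1,2) that
      by (simp add: E_def K_def b_def)
    have refl_deriv: "((\<lambda>m. f (1 - m)) has_real_derivative - f') (at m)"
      if "(f has_real_derivative f') (at (1 - m))" for f f'
    proof -
      have "((\<lambda>m. 1 - m) has_real_derivative - 1) (at m)" by (auto intro!: derivative_eq_intros)
      from DERIV_chain2[where f = f and g = "\<lambda>m. 1 - m" and x = m, OF that this]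
      show ?thesis by simp
    qed
    define e k where "e = E (1 - m)" and "k = K (1 - m)"
    have "((\<lambda>m. E m * K (1 - m) + K m * E (1 - m) - K m * K (1 - m)) has_real_derivative
        (?E' m * k + - ?K' (1 - m) * E m + (?K' m * e + - ?E' (1 - m) * K m)
          - (?K' m * k + - ?K' (1 - m) * K m))) (at m)"
      unfolding e_def k_def using m
      by (intro DERIV_diff DERIV_add DERIV_mult dE dK refl_deriv) auto
    moreover have "?E' m * k + - ?K' (1 - m) * E m + (?K' m * e + - ?E' (1 - m) * K m)
          - (?K' m * k + - ?K' (1 - m) * K m) = 0"
      unfolding e_def[symmetric] k_def[symmetric] using m
      by (simp add: divide_simps) (simp add: algebra_simps)
    ultimately show ?thesis by simp
  qed
  then have "\<exists>C. \<forall>m\<in>{0<..<1}. E m * K (1 - m) + K m * E (1 - m) - K m * K (1 - m) = C"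
    by (intro has_field_derivative_zero_constant) (auto intro: DERIV_subset)
  then show ?thesis using that by auto
qed

text \<open>
  At the parameter \<open>1 - m\<close> the base of the kernel is at least \<open>m\<close>, which controls the growth of
  \<open>K(1 - m)\<close> as \<open>m\<close> tends to \<open>0\<close>.
\<close>

lemma euler_integral_le_powr:
  assumes "a < 1" "1 \<le> q" "0 < m" "m \<le> 1" "c \<le> 0"
  shows "\<bar>euler_integral a q c (1 - m)\<bar>
    \<le> m powr c * integral {0..1} (\<lambda>t. \<bar>euler_weight a q t\<bar>)"
  unfolding euler_integral_def
proof (rule weighted_integral_abs_le)
  fix t :: real assume t: "t \<in> {0..1}"
  have "(1 - m) * t powr q \<le> (1 - m) * 1"
    using assms t by (intro mult_left_mono order_trans[OF powr_le_self]) auto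
  then have "m \<le> 1 - (1 - m) * t powr q" by simp
  then show "\<bar>(1 - (1 - m) * t powr q) powr c\<bar> \<le> m powr c"
    using powr_mono2'[of c m "1 - (1 - m) * t powr q"] assms by simp
qed (use assms in \<open>auto intro!: euler_weight_absolutely_integrable
        euler_kernel_continuous_on_section\<close>)

text \<open>
  The two kernels differ by the factor \<open>1 - m t\<^sup>q\<close>, so their difference is
  \<open>- m t\<^sup>q (1 - m t\<^sup>q)\<^sup>c\<^sup>-\<^sup>1\<close>. The last factor is bounded as long as \<open>m\<close> stays away from
  \<open>1\<close>.
\<close>

lemma euler_integral_difference_bound:
  assumes "a < 1" "1 \<le> q"
  obtains B where "\<And>m. \<lbrakk>0 < m; m \<le> 1/2\<rbrakk> \<Longrightarrow>
    \<bar>euler_integral a q c m - euler_integral a q (c - 1) m\<bar> \<le> B * m"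
proof -
  have "compact ((\<lambda>(x, t). (1 - x * t powr q) powr (c - 1)) ` ({0..1/2} \<times> {0..1}))"
    using assms
    by (intro compact_continuous_image euler_kernel_continuous_on compact_Times) auto
  then obtain B where "\<forall>y \<in> (\<lambda>(x, t). (1 - x * t powr q) powr (c - 1)) ` ({0..1/2} \<times> {0..1}).
      norm y \<le> B"
    using compact_imp_bounded bounded_iff by metis
  then have B: "\<bar>(1 - x * t powr q) powr (c - 1)\<bar> \<le> B" if "x \<in> {0..1/2}" "t \<in> {0..1}" for x t
    using that by force
  let ?W = "integral {0..1} (\<lambda>t. \<bar>euler_weight a q t\<bar>)"
  show ?thesis
  proof
    fix m :: real assume m: "0 < m" "m \<le> 1/2"
    have "euler_integral a q c m - euler_integral a q (c - 1) m
        = integral {0..1} (\<lambda>t. euler_weight a q t *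
            ((1 - m * t powr q) powr c - (1 - m * t powr q) powr (c - 1)))"
      unfolding euler_integral_def using euler_integrand_integrable[of a q m] assms m
      by (simp add: Henstock_Kurzweil_Integration.integral_diff right_diff_distrib)
    also have "\<bar>\<dots>\<bar> \<le> (m * B) * ?W"
    proof (rule weighted_integral_abs_le)
      fix t :: real assume t: "t \<in> {0..1}"
      have pos: "0 < 1 - m * t powr q" using one_minus_mult_powr_pos[of t q m] t m assms by auto
      have "(1 - m * t powr q) powr c - (1 - m * t powr q) powr (c - 1)
          = - (m * t powr q) * (1 - m * t powr q) powr (c - 1)"
        using pos by (simp add: powr_diff field_simps)
      also have "\<bar>\<dots>\<bar> = (m * t powr q) * \<bar>(1 - m * t powr q) powr (c - 1)\<bar>"
        using m by (simp add: abs_mult)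
      also have "\<dots> \<le> (m * 1) * B"
        using B[of m t] m t powr_le_self[of t q] assms
        by (intro mult_mono mult_left_mono) auto
      finally show "\<bar>(1 - m * t powr q) powr c - (1 - m * t powr q) powr (c - 1)\<bar> \<le> m * B" by simp
    qed (use assms m in \<open>auto intro!: euler_weight_absolutely_integrable continuous_on_diff
        euler_kernel_continuous_on_section\<close>)
    finally show "\<bar>euler_integral a q c m - euler_integral a q (c - 1) m\<bar> \<le> (B * ?W) * m"
      by (simp add: mult_ac)
  qed
qed

text \<open>
  The constant is the limit at \<open>m \<rightarrow> 0\<close>. The product of \<open>E - K = O(m)\<close> and
  \<open>K(1 - m) = O(m\<^sup>b\<^sup>-\<^sup>1)\<close> is \<open>O(m\<^sup>b)\<close> with \<open>b = 1/q > 0\<close>, and the rest is continuous.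
\<close>

theorem legendre_relation:
  assumes "a < 1" "1 < q" "0 < m" "m < 1"
  defines "E \<equiv> euler_integral a q (1 / q)" and "K \<equiv> euler_integral a q (1 / q - 1)"
  shows "E m * K (1 - m) + K m * E (1 - m) - K m * K (1 - m) = K 0 * E 1"
proof -
  define L where "L = (\<lambda>m. E m * K (1 - m) + K m * E (1 - m) - K m * K (1 - m))"
  define b where "b = 1 / q"
  have b: "0 < b" "b < 1" using assms by (auto simp: b_def)
  define W where "W = integral {0..1} (\<lambda>t. \<bar>euler_weight a q t\<bar>)"
  obtain C where C: "\<And>m. \<lbrakk>0 < m; m < 1\<rbrakk> \<Longrightarrow> L m = C"
    using legendre_relation_constant[of a q] assms(1,2) by (auto simp: L_def E_def K_def)
  obtain B where B: "\<And>m. \<lbrakk>0 < m; m \<le> 1/2\<rbrakk> \<Longrightarrow> \<bar>E m - K m\<bar> \<le> B * m"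
    using euler_integral_difference_bound[of a q b] assms(1,2) by (auto simp: E_def K_def b_def)
  have near: "\<forall>\<^sub>F m in at_right 0. 0 < m \<and> m < (1/2::real)"
    by (auto simp: eventually_at_right_field intro!: exI[of _ "1/2"])
  have "((\<lambda>m. (E m - K m) * K (1 - m)) \<longlongrightarrow> 0) (at_right 0)"
  proof (rule Lim_null_comparison)
    show "\<forall>\<^sub>F m in at_right 0. norm ((E m - K m) * K (1 - m)) \<le> B * W * m powr b"
      using near
    proof eventually_elim
      case (elim m)
      have "\<bar>K (1 - m)\<bar> \<le> m powr (b - 1) * W"
        using euler_integral_le_powr[of a q m "b - 1"] assms(1,2) b elim
        by (simp add: K_def W_def b_def)
      then have "\<bar>E m - K m\<bar> * \<bar>K (1 - m)\<bar> \<le> (B * m) * (m powr (b - 1) * W)"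
        using B[of m] elim by (intro mult_mono) auto
      also have "\<dots> = B * W * m powr b"
        using elim by (simp add: powr_diff)
      finally show ?case by (simp add: abs_mult)
    qed
    have "((\<lambda>m. B * W * m powr b) \<longlongrightarrow> B * W * 0 powr b) (at_right 0)"
      using b by (intro tendsto_intros tendsto_powr') (auto simp: eventually_at_right_less less_imp_le
          eventually_at_filter)
    then show "((\<lambda>m. B * W * m powr b) \<longlongrightarrow> 0) (at_right 0)" by simp
  qed
  moreover have "((\<lambda>m. K m * E (1 - m)) \<longlongrightarrow> K 0 * E 1) (at_right 0)"
  proof -
    have "continuous_on {0..1/2} K"
      unfolding K_def using assms(1,2) by (intro euler_integral_continuous_on) auto
    moreover have cE: "continuous_on {0..1} E"
      unfolding E_def using assms(1,2) by (intro euler_integral_continuous_on) auto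
    have "continuous_on {0..1/2} (\<lambda>m. E (1 - m))"
      by (rule continuous_on_compose2[OF cE]) (auto intro!: continuous_intros)
    ultimately have "continuous_on {0..1/2} (\<lambda>m. K m * E (1 - m))"
      by (rule continuous_on_mult)
    then have "((\<lambda>m. K m * E (1 - m)) \<longlongrightarrow> K 0 * E (1 - 0)) (at 0 within {0..1/2})"
      unfolding continuous_on by (rule bspec) simp
    moreover have "at 0 within {0..1/2} = at_right (0::real)"
      by (rule at_within_Icc_at_right) simp
    ultimately show ?thesis by simp
  qed
  ultimately have "((\<lambda>m. (E m - K m) * K (1 - m) + K m * E (1 - m)) \<longlongrightarrow> 0 + K 0 * E 1) (at_right 0)"
    by (rule tendsto_add)
  moreover have "\<forall>\<^sub>F m in at_right 0. (E m - K m) * K (1 - m) + K m * E (1 - m) = C"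
    using near by eventually_elim (use C in \<open>auto simp: L_def algebra_simps\<close>)
  ultimately have "((\<lambda>m::real. C) \<longlongrightarrow> 0 + K 0 * E 1) (at_right 0)"
    by (rule Lim_transform_eventually)
  then have "C = K 0 * E 1"
    using tendsto_unique[of "at_right (0::real)" "\<lambda>_. C" C "K 0 * E 1"] by simp
  then show ?thesis using C[of m] assms(3,4) by (simp add: L_def)
qed

section \<open>Generalized elliptic integrals\<close>

lemma conj_exponent_conj_exponent:
  assumes "1 < q"
  shows "conj_exponent (conj_exponent q) = q"
  using assms by (simp add: conj_exponent_def)

lemma K2_eq_euler_integral:
  assumes "1 < q"
  shows "K2 p q k = euler_integral (real_of_ereal (1 / p)) q (1 / q - 1) (k powr q)"
proof -
  have "x powr (1 / q - 1) = 1 / x powr (1 / conj_exponent q)" for x :: real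
    using powr_minus[of x "1 - 1 / q"] assms by (simp add: conj_exponent_def divide_inverse)
  then show ?thesis by (simp add: K2_def K3_def euler_integral_def euler_weight_def)
qed

lemma E2_eq_euler_integral:
  assumes "1 < q"
  shows "E2 p q k = euler_integral (real_of_ereal (1 / p)) q (1 / q) (k powr q)"
  using assms
  by (simp add: E2_def E3_def euler_integral_def euler_weight_def conj_exponent_conj_exponent)

text \<open>
  The two constants are the values of Euler integrals at \<open>m = 0\<close>, where the kernel is \<open>1\<close>
  whatever its exponent, and at \<open>m = 1\<close>, where it merges with the weight. Both identities hold for
  the integrands pointwise, also at \<open>t = 1\<close>, since \<open>0 powr c = 0\<close> and \<open>1 / 0 = 0\<close>.
\<close>

lemma gen_pi_eq_euler_integral_0:
  "gen_pi p q = 2 * euler_integral (real_of_ereal (1 / p)) q c 0"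
  by (simp add: gen_pi_def euler_integral_def euler_weight_def)

lemma gen_pi_eq_euler_integral_1:
  assumes "real_of_ereal (1 / s) = a - c"
  shows "gen_pi s q = 2 * euler_integral a q c 1"
proof -
  have "1 / x powr (a - c) = 1 / x powr a * x powr c" for x :: real
    by (simp add: powr_diff)
  then show ?thesis by (simp add: gen_pi_def euler_integral_def euler_weight_def assms)
qed

lemma Pstar_real_inverse_less_1:
  assumes "p \<in> Pstar"
  shows "real_of_ereal (1 / p) < 1"
  using assms by (cases p) (auto simp: Pstar_def one_ereal_def divide_less_eq)

theorem corollary1p2:
  fixes p s :: ereal and q k k' :: real
  assumes "p \<in> Pstar"
    and "1 < q"
    and "0 < k" and "k < 1"
    and "k' = (1 - k powr q) powr (1 / q)"
    and "1 / s = 1 / p - 1 / ereal q"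
  shows "E2 p q k * K2 p q k' + K2 p q k * E2 p q k' - K2 p q k * K2 p q k'
           = gen_pi p q * gen_pi s q / 4"
proof -
  define a where "a = real_of_ereal (1 / p)"
  have a: "a < 1" using Pstar_real_inverse_less_1[OF assms(1)] by (simp add: a_def)
  have m: "0 < k powr q" "k powr q < 1"
    using assms powr_less_mono2[of q k 1] by auto
  have k': "k' powr q = 1 - k powr q"
    using m assms by (simp add: powr_powr)
  have "real_of_ereal (1 / s) = a - 1 / q"
    using assms(1,2,6) by (cases p) (auto simp: a_def Pstar_def one_ereal_def)
  then have "gen_pi s q = 2 * euler_integral a q (1 / q) 1"
    by (rule gen_pi_eq_euler_integral_1)
  moreover have "gen_pi p q = 2 * euler_integral a q (1 / q - 1) 0"
    unfolding a_def by (rule gen_pi_eq_euler_integral_0)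
  ultimately show ?thesis
    using legendre_relation[OF a assms(2) m]
    by (simp add: K2_eq_euler_integral[OF assms(2)] E2_eq_euler_integral[OF assms(2)] k'
        a_def[symmetric])
qed

end
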